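(* The closure in $\mathbb{R}$ of the set of real bichromatic roots is $\mathbb{R}$.
   Context: All graphs are finite and simple. A $2$-edge-coloured graph is a triple $G=(\Gamma,R,B)$ with $R,B\subseteq E(\Gamma)$, $R\cap B=\emptyset$, $R\cup B=E(\Gamma)$ (red and blue edges); it is bichromatic if $R\ne\emptyset$ and $B\ne\emptyset$. A $k$-colouring of $G$ is a proper vertex colouring $c:V(\Gamma)\to\{1,\dots,k\}$ of $\Gamma$ such that for every $ux\in R$ and $vy\in B$ (either endpoint may play the role of $u$, resp. $v$), $c(u)=c(v)$ implies $c(x)\ne c(y)$. $P(G,\lambda)$ is the polynomial whose value at each non-negative integer $k$ is the number of $k$-colourings of $G$. A bichromatic root is a complex number that is a root of $P(G,\lambda)$ for some bichromatic $2$-edge-coloured graph $G$. *)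

theory Defs
  imports "HOL-Analysis.Analysis" "HOL-Computational_Algebra.Polynomial"
begin

record 'a tec_graph =
  verts :: "'a set"
  edges :: "'a set set"
  red :: "'a set set"
  blue :: "'a set set"

definition finite_simple_graph :: "'a set \<Rightarrow> 'a set set \<Rightarrow> bool" where
  "finite_simple_graph V E \<longleftrightarrow> finite V \<and> (\<forall>e\<in>E. e \<subseteq> V \<and> card e = 2)"

definition two_edge_coloured_graph :: "'a tec_graph \<Rightarrow> bool" where
  "two_edge_coloured_graph G \<longleftrightarrow>
     finite_simple_graph (verts G) (edges G) \<and>
     red G \<subseteq> edges G \<and> blue G \<subseteq> edges G \<and>
     red G \<inter> blue G = {} \<and> red G \<union> blue G = edges G"

definition bichromatic :: "'a tec_graph \<Rightarrow> bool" where
  "bichromatic G \<longleftrightarrow> red G \<noteq> {} \<and> blue G \<noteq> {}"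

definition proper_colouring :: "'a set set \<Rightarrow> ('a \<Rightarrow> nat) \<Rightarrow> bool" where
  "proper_colouring E c \<longleftrightarrow> (\<forall>u v. {u, v} \<in> E \<longrightarrow> c u \<noteq> c v)"

(* Colourings are extensional, so that each map from the vertex set to {1..k} is counted
   exactly once.  Since edges are unordered pairs, the quantifier over u, x, v, y
   covers both ways of naming the endpoints of each edge. *)
definition colourings :: "'a tec_graph \<Rightarrow> nat \<Rightarrow> ('a \<Rightarrow> nat) set" where
  "colourings G k =
     {c \<in> verts G \<rightarrow>\<^sub>E {1..k}. proper_colouring (edges G) c \<and>
        (\<forall>u x v y. {u, x} \<in> red G \<longrightarrow> {v, y} \<in> blue G \<longrightarrow> c u = c v \<longrightarrow> c x \<noteq> c y)}"

(* Existence and uniqueness are shown in chromatic_poly_ex1 below. *)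
definition chromatic_poly :: "'a tec_graph \<Rightarrow> complex poly" where
  "chromatic_poly G = (THE p. \<forall>k. poly p (of_nat k) = of_nat (card (colourings G k)))"

(* Every finite graph is isomorphic to one whose vertices are natural numbers, and the number
   of colourings is invariant under isomorphism, so the vertex type nat loses nothing. *)
definition bichromatic_root :: "complex \<Rightarrow> bool" where
  "bichromatic_root z \<longleftrightarrow>
     (\<exists>G :: nat tec_graph. two_edge_coloured_graph G \<and> bichromatic G \<and>
        poly (chromatic_poly G) z = 0)"

lemma poly_eq_of_nat_unique:
  fixes p q :: "complex poly"
  assumes "\<And>k::nat. poly p (of_nat k) = poly q (of_nat k)"
  shows "p = q"
proof (rule ccontr)
  assume "p \<noteq> q"
  then have "finite {x. poly (p - q) x = 0}" by (intro poly_roots_finite) simp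
  moreover have "range (of_nat :: nat \<Rightarrow> complex) \<subseteq> {x. poly (p - q) x = 0}"
    using assms by auto
  ultimately have "finite (range (of_nat :: nat \<Rightarrow> complex))"
    by (rule rev_finite_subset)
  then have "finite (UNIV :: nat set)"
    by (rule finite_imageD) (simp add: inj_on_def)
  then show False by simp
qed

lemma card_colourings_with_image:
  assumes G: "two_edge_coloured_graph G" and S: "S \<subseteq> {1..k}"
  shows "card {c \<in> colourings G k. c ` verts G = S} =
         card {c \<in> colourings G (card S). c ` verts G = {1..card S}}"
proof -
  let ?V = "verts G"
  have fin: "finite S" using S finite_subset by blast
  then obtain h where h: "bij_betw h S {1..card S}"
    using finite_same_card_bij[of S "{1..card S}"] by auto
  define g where "g = inv_into S h"
  have g: "bij_betw g {1..card S} S" unfolding g_def using h by (rule bij_betw_inv_into)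
  have gh: "g (h s) = s" if "s \<in> S" for s
    unfolding g_def using h that by (meson bij_betw_inv_into_left)
  have hg: "h (g s) = s" if "s \<in> {1..card S}" for s
    unfolding g_def using h that by (meson bij_betw_inv_into_right)
  have inV: "u \<in> ?V \<and> x \<in> ?V" if "{u, x} \<in> edges G" for u x
  proof -
    have "{u, x} \<subseteq> ?V"
      using G that unfolding two_edge_coloured_graph_def finite_simple_graph_def by metis
    then show ?thesis by simp
  qed
  have sub: "red G \<subseteq> edges G" "blue G \<subseteq> edges G"
    using G unfolding two_edge_coloured_graph_def by auto
  have transfer: "restrict (f \<circ> c) ?V \<in> {c \<in> colourings G m. c ` ?V = T'}"
    if c: "c \<in> {c \<in> colourings G l. c ` ?V = T}" and f: "bij_betw f T T'" and T': "T' \<subseteq> {1..m}"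
    for f c l m T T'
  proof -
    let ?d = "restrict (f \<circ> c) ?V"
    have eq: "?d u = ?d v \<longleftrightarrow> c u = c v" if "u \<in> ?V" "v \<in> ?V" for u v
      using that c f by (auto simp: bij_betw_def inj_on_def)
    have im: "?d ` ?V = T'"
    proof -
      have "?d ` ?V = f ` (c ` ?V)" by auto
      then show ?thesis using c f by (simp add: bij_betw_def)
    qed
    have ext: "?d \<in> ?V \<rightarrow>\<^sub>E {1..m}" using im T' by (auto simp: PiE_def)
    have "proper_colouring (edges G) ?d"
      unfolding proper_colouring_def
    proof (intro allI impI)
      fix u v assume uv: "{u, v} \<in> edges G"
      then have "c u \<noteq> c v" using c unfolding colourings_def proper_colouring_def by simp
      then show "?d u \<noteq> ?d v" using eq inV[OF uv] by simp
    qed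
    moreover have "?d x \<noteq> ?d y"
      if "{u, x} \<in> red G" "{v, y} \<in> blue G" "?d u = ?d v" for u x v y
    proof -
      have V: "u \<in> ?V \<and> x \<in> ?V" "v \<in> ?V \<and> y \<in> ?V"
        using inV[of u x] inV[of v y] that(1,2) sub by blast+
      then have "c u = c v" using eq that(3) by simp
      moreover have "\<forall>u x v y. {u, x} \<in> red G \<longrightarrow> {v, y} \<in> blue G \<longrightarrow>
          c u = c v \<longrightarrow> c x \<noteq> c y"
        using c unfolding colourings_def by simp
      ultimately have "c x \<noteq> c y" using that(1,2) by metis
      then show ?thesis using eq V by simp
    qed
    ultimately have "?d \<in> colourings G m"
      using ext unfolding colourings_def by simp
    then show ?thesis using im by simp
  qed
  let ?A = "{c \<in> colourings G k. c ` ?V = S}"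
  let ?B = "{c \<in> colourings G (card S). c ` ?V = {1..card S}}"
  have inv1: "restrict (g \<circ> restrict (h \<circ> c) ?V) ?V = c" if "c \<in> ?A" for c
    using that gh unfolding colourings_def by (auto simp: fun_eq_iff PiE_def extensional_def)
  have inv2: "restrict (h \<circ> restrict (g \<circ> c) ?V) ?V = c" if "c \<in> ?B" for c
  proof
    fix x
    have "c x \<in> {1..card S}" if "x \<in> ?V" using \<open>c \<in> ?B\<close> that by blast
    then show "restrict (h \<circ> restrict (g \<circ> c) ?V) ?V x = c x"
      using that hg unfolding colourings_def by (auto simp: PiE_def extensional_def)
  qed
  have "bij_betw (\<lambda>c. restrict (h \<circ> c) ?V) ?A ?B"
  proof (rule bij_betw_byWitness[where f' = "\<lambda>c. restrict (g \<circ> c) ?V"])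
    show "(\<lambda>c. restrict (h \<circ> c) ?V) ` ?A \<subseteq> ?B"
      by (rule image_subsetI, rule transfer[OF _ h], assumption) simp
    show "(\<lambda>c. restrict (g \<circ> c) ?V) ` ?B \<subseteq> ?A"
      by (rule image_subsetI, rule transfer[OF _ g S], assumption)
  qed (intro ballI inv1 inv2, assumption)+
  then show ?thesis by (rule bij_betw_same_card)
qed

lemma card_colourings_eq_sum:
  assumes G: "two_edge_coloured_graph G"
  shows "card (colourings G k) =
    (\<Sum>j\<le>card (verts G). (k choose j) * card {c \<in> colourings G j. c ` verts G = {1..j}})"
proof -
  let ?V = "verts G"
  let ?N = "\<lambda>j. card {c \<in> colourings G j. c ` ?V = {1..j}}"
  have finV: "finite ?V"
    using G unfolding two_edge_coloured_graph_def finite_simple_graph_def by simp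
  have finC: "finite (colourings G k)" for k
    unfolding colourings_def using finV by (simp add: finite_PiE)
  have "colourings G k = (\<Union>S\<in>Pow {1..k}. {c \<in> colourings G k. c ` ?V = S})"
    unfolding colourings_def by auto
  then have "card (colourings G k) = card (\<Union>S\<in>Pow {1..k}. {c \<in> colourings G k. c ` ?V = S})"
    by simp
  also have "\<dots> = (\<Sum>S\<in>Pow {1..k}. card {c \<in> colourings G k. c ` ?V = S})"
    by (rule card_UN_disjoint) (use finC in auto)
  also have "\<dots> = (\<Sum>S\<in>Pow {1..k}. ?N (card S))"
    by (intro sum.cong refl card_colourings_with_image[OF G]) (erule PowD)
  also have "\<dots> = (\<Sum>j\<le>k. \<Sum>S\<in>{S \<in> Pow {1..k}. card S = j}. ?N (card S))"
  proof (rule sum.group[symmetric])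
    have "card S \<le> k" if "S \<subseteq> {1..k}" for S
      using card_mono[OF finite_atLeastAtMost that] by simp
    then show "card ` Pow {1..k} \<subseteq> {..k}" by blast
  qed simp_all
  also have "\<dots> = (\<Sum>j\<le>k. (k choose j) * ?N j)"
  proof (rule sum.cong)
    fix j
    have "card {S \<in> Pow {1..k}. card S = j} = k choose j"
      using n_subsets[of "{1..k}" j] by simp
    then show "(\<Sum>S\<in>{S \<in> Pow {1..k}. card S = j}. ?N (card S)) = (k choose j) * ?N j"
      by simp
  qed simp
  also have "\<dots> = (\<Sum>j\<le>max k (card ?V). (k choose j) * ?N j)"
    by (rule sum.mono_neutral_left) (auto simp: binomial_eq_0)
  also have "\<dots> = (\<Sum>j\<le>card ?V. (k choose j) * ?N j)"
  proof (rule sum.mono_neutral_right)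
    show "\<forall>j\<in>{..max k (card ?V)} - {..card ?V}. (k choose j) * ?N j = 0"
    proof
      fix j assume j: "j \<in> {..max k (card ?V)} - {..card ?V}"
      have "c ` ?V \<noteq> {1..j}" for c :: "'a \<Rightarrow> nat"
        using card_image_le[OF finV, of c] j by auto
      then have "{c \<in> colourings G j. c ` ?V = {1..j}} = {}" by blast
      then show "(k choose j) * ?N j = 0" by (simp only: card.empty mult_0_right)
    qed
  qed auto
  finally show ?thesis .
qed

lemma chromatic_poly_ex1:
  assumes G: "two_edge_coloured_graph G"
  shows "\<exists>!p :: complex poly. \<forall>k. poly p (of_nat k) = of_nat (card (colourings G k))"
proof -
  define b :: "nat \<Rightarrow> complex poly"
    where "b j = smult (1 / fact j) (\<Prod>i = 0..<j. [:- of_nat i, 1:])" for j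
  have b: "poly (b j) (of_nat k) = of_nat (k choose j)" for j k
    unfolding b_def binomial_gbinomial gbinomial_prod_rev by (simp add: poly_prod)
  define p where
    "p = (\<Sum>j\<le>card (verts G). b j * of_nat (card {c \<in> colourings G j. c ` verts G = {1..j}}))"
  have "poly p (of_nat k) = of_nat (card (colourings G k))" for k
    unfolding p_def card_colourings_eq_sum[OF G, of k] by (simp add: poly_sum b)
  then show ?thesis
    by (intro ex1I[of _ p]) (auto intro!: poly_eq_of_nat_unique)
qed

lemma poly_chromatic_poly:
  assumes "two_edge_coloured_graph G"
  shows "poly (chromatic_poly G) (of_nat k) = of_nat (card (colourings G k))"
  using theI'[OF chromatic_poly_ex1[OF assms]] unfolding chromatic_poly_def by blast

end

theory Submission
  imports Defs
begin

text \<open>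
  Take a red clique on \<open>n + q\<close> vertices and a blue path with three vertices, each of which is
  joined by red edges to \<open>q\<close> fixed vertices of the clique. The clique uses up all red colour pairs
  among its colours, so the number of choices for the path depends only on whether the colour of
  its centre occurs on the other \<open>n\<close> clique vertices. This gives the factor
  \<open>n (z - n) + (z - 1)\<^sup>2\<close> at \<open>z = \<lambda> - q\<close> (\<open>\<lambda>\<close> the number of colours), one of whose roots is
  \<open>1 - (n + sqrt (5 n\<^sup>2 - 4 n)) / 2 = 1 + 1 / sqrt 5 - n \<phi> + O(1/n)\<close>, where \<open>\<phi>\<close> is the golden
  ratio. As \<open>\<phi>\<close> is irrational and \<open>q\<close> shifts the roots by integers, Kronecker's theorem makes
  them dense.
\<close>

section \<open>The graphs and a description of their colourings\<close>

text \<open>The vertices below \<open>q\<close> are the clique vertices joined to the path, and the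
  other \<open>n\<close> clique vertices follow. The path has centre \<open>n + q\<close> and ends
  \<open>n + q + 1\<close> and \<open>n + q + 2\<close>. As \<open>i < j\<close>, the condition
  \<open>j < n + q\<close> places the whole edge inside the clique.\<close>

definition clique_path_graph :: "nat \<Rightarrow> nat \<Rightarrow> nat tec_graph" where
  "clique_path_graph n q =
     (let R = {{i, j} |i j. i < j \<and> j < n + q + 3 \<and> (i < q \<or> j < n + q)};
          B = {{n + q, n + q + 1}, {n + q, n + q + 2}}
      in \<lparr>verts = {..<n + q + 3}, edges = R \<union> B, red = R, blue = B\<rparr>)"

lemma two_edge_coloured_clique_path_graph: "two_edge_coloured_graph (clique_path_graph n q)"
  by (auto simp: two_edge_coloured_graph_def finite_simple_graph_def clique_path_graph_def Let_def
      doubleton_eq_iff)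

lemma red_clique_path_graph_iff:
  "{u, v} \<in> red (clique_path_graph n q) \<longleftrightarrow>
     u \<noteq> v \<and> u < n + q + 3 \<and> v < n + q + 3 \<and> (u < q \<or> v < q \<or> u < n + q \<and> v < n + q)"
proof -
  have "{u, v} \<in> red (clique_path_graph n q) \<longleftrightarrow>
     (u < v \<and> v < n + q + 3 \<and> (u < q \<or> v < n + q)) \<or> (v < u \<and> u < n + q + 3 \<and> (v < q \<or> u < n + q))"
    by (auto simp: clique_path_graph_def Let_def doubleton_eq_iff)
  also have "\<dots> \<longleftrightarrow> u \<noteq> v \<and> u < n + q + 3 \<and> v < n + q + 3 \<and> (u < q \<or> v < q \<or> u < n + q \<and> v < n + q)"
    by linarith
  finally show ?thesis .
qed

lemma blue_clique_path_graph_iff: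
  "{u, v} \<in> blue (clique_path_graph n q) \<longleftrightarrow>
     (u = n + q \<and> v \<in> {n + q + 1, n + q + 2}) \<or> (v = n + q \<and> u \<in> {n + q + 1, n + q + 2})"
  by (auto simp: clique_path_graph_def Let_def doubleton_eq_iff)

lemma bichromatic_clique_path_graph:
  assumes "n \<ge> 2"
  shows "bichromatic (clique_path_graph n q)"
proof -
  have "{0, 1} \<in> red (clique_path_graph n q)"
    unfolding red_clique_path_graph_iff using assms by simp
  then show ?thesis
    by (auto simp: bichromatic_def clique_path_graph_def Let_def)
qed

text \<open>The path avoids the colours of the first \<open>q\<close> vertices, so red edges at
  those vertices never clash with a blue edge. Any two distinct colours on the clique already form a
  red pair, so a blue edge must not have both its colours there. The two blue edges do not constrain
  each other.\<close>

lemma colourings_clique_path_graph_iff: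
  "c \<in> colourings (clique_path_graph n q) k \<longleftrightarrow>
     c \<in> {..<n + q + 3} \<rightarrow>\<^sub>E {1..k} \<and> inj_on c {..<n + q} \<and> c (n + q) \<notin> c ` {..<q} \<and>
     (\<forall>v\<in>{n + q + 1, n + q + 2}. c v \<notin> c ` {..<q} \<and> c (n + q) \<noteq> c v \<and>
        (c (n + q) \<in> c ` {..<n + q} \<longrightarrow> c v \<notin> c ` {..<n + q}))"
    (is "_ \<longleftrightarrow> ?ext \<and> ?inj \<and> ?centre \<and> ?ends")
proof
  let ?G = "clique_path_graph n q"
  have edges: "edges ?G = red ?G \<union> blue ?G" and verts: "verts ?G = {..<n + q + 3}"
    by (auto simp: clique_path_graph_def Let_def)
  {
    assume c: "c \<in> colourings ?G k"
    then have proper: "c u \<noteq> c v" if "{u, v} \<in> red ?G \<or> {u, v} \<in> blue ?G" for u v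
      using that by (auto simp: colourings_def proper_colouring_def edges)
    have pairs: "c x \<noteq> c y" if "{u, x} \<in> red ?G" "{v, y} \<in> blue ?G" "c u = c v" for u x v y
      using that c unfolding colourings_def by blast
    have ?ext using c by (simp add: colourings_def verts)
    moreover have ?inj
      by (rule inj_onI, rule ccontr) (use proper in \<open>force simp: red_clique_path_graph_iff\<close>)
    moreover have ?centre
      using proper by (fastforce simp: red_clique_path_graph_iff)
    moreover have ?ends
    proof
      fix v assume v: "v \<in> {n + q + 1, n + q + 2}"
      have blue: "{n + q, v} \<in> blue ?G" using v by (auto simp: blue_clique_path_graph_iff)
      have 1: "c v \<notin> c ` {..<q}"
        using proper v by (fastforce simp: red_clique_path_graph_iff)
      have 2: "c (n + q) \<noteq> c v" using proper blue by blast
      \<comment> \<open>Otherwise the red edge between \<open>i\<close> and \<open>j\<close> carries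
        the same colour pair as the blue edge.\<close>
      have 3: "c v \<noteq> c j" if "c (n + q) = c i" "i < n + q" "j < n + q" for i j
      proof
        assume eq: "c v = c j"
        then have "i \<noteq> j" using 2 that(1) by auto
        then have "{i, j} \<in> red ?G" using that by (simp add: red_clique_path_graph_iff)
        then show False using pairs[OF _ blue] that(1) eq by metis
      qed
      show "c v \<notin> c ` {..<q} \<and> c (n + q) \<noteq> c v \<and>
        (c (n + q) \<in> c ` {..<n + q} \<longrightarrow> c v \<notin> c ` {..<n + q})"
        using 1 2 3 by auto
    qed
    ultimately show "?ext \<and> ?inj \<and> ?centre \<and> ?ends" by blast
  }
  {
    assume *: "?ext \<and> ?inj \<and> ?centre \<and> ?ends"
    have path: "c v \<noteq> c i" if "v \<ge> n + q" "v < n + q + 3" "i < q" for v i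
    proof -
      have "v \<in> {n + q, n + q + 1, n + q + 2}" using that by auto
      then show ?thesis using * that(3) by auto
    qed
    have ends: "c (n + q) \<noteq> c v" "c (n + q) = c i \<Longrightarrow> i < n + q \<Longrightarrow> j < n + q \<Longrightarrow> c v \<noteq> c j"
      if "v \<in> {n + q + 1, n + q + 2}" for v i j
      using * that by auto
    have red: "c u \<noteq> c v" if "{u, v} \<in> red ?G" for u v
    proof (cases "u < n + q \<and> v < n + q")
      case True
      then show ?thesis
        using * that by (auto simp: red_clique_path_graph_iff dest: inj_onD)
    next
      case False
      then show ?thesis
        using that path[of u v] path[of v u] by (auto simp: red_clique_path_graph_iff)
    qed
    moreover have "c u \<noteq> c v" if "{u, v} \<in> blue ?G" for u v
      using that ends(1)[of u] ends(1)[of v] by (auto simp: blue_clique_path_graph_iff)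
    \<comment> \<open>A red edge repeating the colours of a blue edge has no endpoint below
      \<open>q\<close>, hence lies inside the clique, and then \<open>ends\<close> excludes
      it.\<close>
    moreover have no_clash: False
      if r: "{u, x} \<in> red ?G" and v: "v \<in> {n + q + 1, n + q + 2}" and eq: "c u = c (n + q)" "c x = c v"
      for u x v
    proof -
      have "u \<ge> q" using path[of "n + q" u] eq by fastforce
      moreover have "x \<ge> q" using path[of v x] eq v by fastforce
      ultimately have "u < n + q" "x < n + q" using r by (auto simp: red_clique_path_graph_iff)
      then show False using ends(2)[OF v, of u x] eq by auto
    qed
    have "c x \<noteq> c y" if r: "{u, x} \<in> red ?G" and b: "{v, y} \<in> blue ?G" and eq: "c u = c v" for u x v y
    proof
      assume eq2: "c x = c y"
      from b consider "v = n + q" "y \<in> {n + q + 1, n + q + 2}" | "y = n + q" "v \<in> {n + q + 1, n + q + 2}"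
        by (auto simp: blue_clique_path_graph_iff)
      then show False
      proof cases
        case 1
        then show False using no_clash[OF r, of y] eq eq2 by simp
      next
        case 2
        then show False using no_clash[of x u v] r eq eq2 by (simp add: insert_commute)
      qed
    qed
    ultimately show "c \<in> colourings ?G k"
      using * unfolding colourings_def proper_colouring_def edges verts by blast
  }
qed

section \<open>Counting the colourings and the chromatic polynomial\<close>

text \<open>Here \<open>f\<close> colours the clique, \<open>a\<close> is the colour of the centre,
  and \<open>D a\<close> is the set of colours open to each end; the ends choose independently. The
  first summand counts centres that repeat one of the \<open>n\<close> colours of the clique
  vertices not joined to the path, the second those with a colour new to the clique.\<close>

lemma card_path_colourings:
  fixes f :: "nat \<Rightarrow> 'a"
  assumes "finite K" and f: "inj_on f {..<n + q}" "f ` {..<n + q} \<subseteq> K"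
  defines "D \<equiv> \<lambda>a. if a \<in> f ` {..<n + q} then K - f ` {..<n + q} else K - f ` {..<q} - {a}"
  shows "card (SIGMA a : K - f ` {..<q}. D a \<times> D a) =
     n * (card K - (n + q))\<^sup>2 + (card K - (n + q)) * (card K - q - 1)\<^sup>2"
proof -
  let ?A = "f ` {..<q}" and ?C = "f ` {q..<n + q}" and ?F = "f ` {..<n + q}"
  have cardF: "card ?F = n + q" using f by (simp add: card_image)
  have cardA: "card ?A = q"
    using card_image[OF inj_on_subset[OF f(1), of "{..<q}"]] by auto
  have cardC: "card ?C = n"
    using card_image[OF inj_on_subset[OF f(1), of "{q..<n + q}"]] by (simp add: subset_eq)
  have AF: "?A \<subseteq> ?F" by auto
  have "{..<n + q} = {..<q} \<union> {q..<n + q}" by auto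
  then have F: "?F = ?A \<union> ?C" by (metis image_Un)
  have "?A \<inter> ?C = {}" using f(1) by (auto dest: inj_onD)
  then have split: "K - ?A = ?C \<union> (K - ?F)" "?C \<inter> (K - ?F) = {}"
    using F f(2) by auto
  have "card (SIGMA a : K - ?A. D a \<times> D a) = (\<Sum>a\<in>K - ?A. (card (D a))\<^sup>2)"
    using assms(1) by (simp add: D_def card_cartesian_product power2_eq_square)
  also have "\<dots> = (\<Sum>a\<in>?C. (card (D a))\<^sup>2) + (\<Sum>a\<in>K - ?F. (card (D a))\<^sup>2)"
    unfolding split(1) by (rule sum.union_disjoint) (use split assms(1) in auto)
  also have "(\<Sum>a\<in>?C. (card (D a))\<^sup>2) = (\<Sum>a\<in>?C. (card K - (n + q))\<^sup>2)"
    by (rule sum.cong[OF refl]) (use F f cardF in \<open>simp add: D_def card_Diff_subset\<close>)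
  also have "(\<Sum>a\<in>K - ?F. (card (D a))\<^sup>2) = (\<Sum>a\<in>K - ?F. (card K - q - 1)\<^sup>2)"
  proof (rule sum.cong[OF refl])
    fix a assume a: "a \<in> K - ?F"
    then have "D a = K - ?A - {a}" and "a \<in> K - ?A" using AF by (auto simp: D_def)
    then show "(card (D a))\<^sup>2 = (card K - q - 1)\<^sup>2"
      using AF f(2) cardA by (simp add: card_Diff_subset subset_trans)
  qed
  finally show ?thesis
    using cardC cardF f(2) by (simp add: card_Diff_subset)
qed

text \<open>The number of ways to colour the path is the same for every colouring of the clique, so
  the counts multiply. For \<open>k < n + q\<close> the factor with \<open>i = k\<close> vanishes,
  so truncated subtraction does no harm.\<close>

lemma card_colourings_clique_path_graph:
  "card (colourings (clique_path_graph n q) k) =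
     (\<Prod>i = 0..<n + q. k - i) *
     (n * (k - (n + q))\<^sup>2 + (k - (n + q)) * (k - q - 1)\<^sup>2)"
proof -
  let ?N = "n + q" and ?K = "{1..k}"
  define I where "I = {f \<in> {..<?N} \<rightarrow>\<^sub>E ?K. inj_on f {..<?N}}"
  define D where
    "D f a = (if a \<in> f ` {..<?N} then ?K - f ` {..<?N} else ?K - f ` {..<q} - {a})"
    for f :: "nat \<Rightarrow> nat" and a
  define T where "T f = (SIGMA a : ?K - f ` {..<q}. D f a \<times> D f a)" for f
  \<comment> \<open>Restricting the clique part makes it extensional, so that it ranges over exactly
    the injections counted by \<open>cardI\<close>.\<close>
  define fw where "fw c = (restrict c {..<?N}, c ?N, c (?N + 1), c (?N + 2))" for c :: "nat \<Rightarrow> nat"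
  define bw where "bw = (\<lambda>(f :: nat \<Rightarrow> nat, a, b, b'). f(?N := a, ?N + 1 := b, ?N + 2 := b'))"
  have "finite I" unfolding I_def by (simp add: finite_PiE)
  have cardI: "card I = (\<Prod>i = 0..<?N. k - i)"
    unfolding I_def using card_inj_on_subset_funcset[of "{..<?N}" ?K "{..<?N}"] by simp
  have cardT: "card (T f) = n * (k - ?N)\<^sup>2 + (k - ?N) * (k - q - 1)\<^sup>2" if "f \<in> I" for f
    using card_path_colourings[of ?K f n q] that unfolding I_def T_def D_def by auto
  have verts: "{..<?N + 3} = insert (?N + 2) (insert (?N + 1) (insert ?N {..<?N}))" by auto
  have "bij_betw fw (colourings (clique_path_graph n q) k) (Sigma I T)"
  proof (rule bij_betw_byWitness[where f' = bw])
    show "\<forall>c\<in>colourings (clique_path_graph n q) k. bw (fw c) = c"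
    proof
      fix c assume "c \<in> colourings (clique_path_graph n q) k"
      then have "c \<in> extensional {..<?N + 3}"
        unfolding colourings_clique_path_graph_iff by (simp add: PiE_def)
      then show "bw (fw c) = c"
        unfolding verts by (auto simp: fw_def bw_def fun_eq_iff extensional_def)
    qed
    show "\<forall>t\<in>Sigma I T. fw (bw t) = t"
      by (auto simp: fw_def bw_def I_def fun_eq_iff PiE_def extensional_def)
    show "fw ` colourings (clique_path_graph n q) k \<subseteq> Sigma I T"
    proof (rule image_subsetI)
      fix c assume c: "c \<in> colourings (clique_path_graph n q) k"
      then have "c v \<in> ?K" if "v < ?N + 3" for v
        using that unfolding colourings_clique_path_graph_iff by auto
      then have "restrict c {..<?N} \<in> I" "c ?N \<in> ?K" "c (?N + 1) \<in> ?K" "c (?N + 2) \<in> ?K"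
        using c unfolding colourings_clique_path_graph_iff I_def by auto
      moreover have "restrict c {..<?N} ` {..<?N} = c ` {..<?N}"
        "restrict c {..<?N} ` {..<q} = c ` {..<q}"
        by (auto simp: image_iff)
      ultimately show "fw c \<in> Sigma I T"
        using c unfolding colourings_clique_path_graph_iff fw_def T_def D_def
        by simp
    qed
    show "bw ` Sigma I T \<subseteq> colourings (clique_path_graph n q) k"
    proof clarify
      fix f a b b' assume f: "f \<in> I" and t: "(a, b, b') \<in> T f"
      define c where "c = bw (f, a, b, b')"
      have c: "c ?N = a" "c (?N + 1) = b" "c (?N + 2) = b'" "\<And>i. i < ?N \<Longrightarrow> c i = f i"
        by (auto simp: c_def bw_def)
      then have im: "c ` {..<?N} = f ` {..<?N}" "c ` {..<q} = f ` {..<q}"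
        by (auto simp: image_iff)
      have inj: "inj_on c {..<?N}"
        using f c(4) unfolding I_def by (auto simp: inj_on_def)
      have "f ` {..<q} \<subseteq> f ` {..<?N}" by auto
      then have t': "a \<in> ?K - f ` {..<q}" "\<forall>d\<in>{b, b'}. d \<in> ?K - f ` {..<q} \<and> a \<noteq> d \<and>
          (a \<in> f ` {..<?N} \<longrightarrow> d \<notin> f ` {..<?N})"
        using t unfolding T_def D_def by (auto split: if_splits)
      then have "c \<in> {..<?N + 3} \<rightarrow>\<^sub>E ?K"
        using f unfolding c_def bw_def verts I_def by (auto intro!: PiE_fun_upd)
      then show "bw (f, a, b, b') \<in> colourings (clique_path_graph n q) k"
        using inj t' unfolding c_def[symmetric] colourings_clique_path_graph_iff im
        using c by simp
    qed
  qed
  then have "card (colourings (clique_path_graph n q) k) = card (Sigma I T)"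
    by (rule bij_betw_same_card)
  also have "\<dots> = (\<Sum>f\<in>I. card (T f))"
    using \<open>finite I\<close> by (simp add: T_def D_def)
  also have "\<dots> = (\<Prod>i = 0..<?N. k - i) * (n * (k - ?N)\<^sup>2 + (k - ?N) * (k - q - 1)\<^sup>2)"
    using cardI cardT by simp
  finally show ?thesis .
qed

text \<open>Both summands of the path count share the factor \<open>k - (n + q)\<close>, which is
  pulled out here.\<close>

lemma poly_chromatic_poly_clique_path_graph:
  assumes "n > 0"
  shows "poly (chromatic_poly (clique_path_graph n q)) z =
     (\<Prod>i = 0..<n + q. z - of_nat i) * (z - of_nat (n + q)) *
     (of_nat n * (z - of_nat (n + q)) + (z - of_nat q - 1)\<^sup>2)"
proof -
  define p :: "complex poly" where
    "p = (\<Prod>i = 0..<n + q. [:- of_nat i, 1:]) * [:- of_nat (n + q), 1:] *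
       (smult (of_nat n) [:- of_nat (n + q), 1:] + [:- of_nat q - 1, 1:]\<^sup>2)"
  have p: "poly p w = (\<Prod>i = 0..<n + q. w - of_nat i) * (w - of_nat (n + q)) *
     (of_nat n * (w - of_nat (n + q)) + (w - of_nat q - 1)\<^sup>2)" for w
    by (simp add: p_def poly_prod algebra_simps)
  \<comment> \<open>In this range no subtraction is truncated; \<open>n > 0\<close> ensures this for
    \<open>k - q - 1\<close>. Infinitely many such \<open>k\<close> remain to identify the
    polynomials.\<close>
  have eq: "poly p (of_nat k) = poly (chromatic_poly (clique_path_graph n q)) (of_nat k)"
    if "k \<ge> n + q" for k
  proof -
    have "of_nat (\<Prod>i = 0..<n + q. k - i) = (\<Prod>i = 0..<n + q. of_nat k - of_nat i :: complex)"
      unfolding of_nat_prod by (rule prod.cong) (use that in \<open>auto simp: of_nat_diff\<close>)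
    then show ?thesis
      using that assms
      unfolding p poly_chromatic_poly[OF two_edge_coloured_clique_path_graph]
        card_colourings_clique_path_graph
      by (simp add: of_nat_diff diff_diff_eq power2_eq_square) (simp add: algebra_simps)
  qed
  have "p = chromatic_poly (clique_path_graph n q)"
  proof (rule ccontr)
    assume "p \<noteq> chromatic_poly (clique_path_graph n q)"
    then have "finite {x. poly (p - chromatic_poly (clique_path_graph n q)) x = 0}"
      by (intro poly_roots_finite) simp
    moreover have "of_nat ` {n + q..} \<subseteq> {x. poly (p - chromatic_poly (clique_path_graph n q)) x = 0}"
      using eq by auto
    ultimately have "finite (of_nat ` {n + q..} :: complex set)"
      by (rule rev_finite_subset)
    then have "finite {n + q..}"
      by (rule finite_imageD) (simp add: inj_on_def)
    then show False by (simp add: infinite_Ici)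
  qed
  then show ?thesis using p by metis
qed

section \<open>A root of the quadratic factor and its asymptotics\<close>

text \<open>Obtained by solving \<open>n (z - n) + (z - 1)\<^sup>2 = 0\<close>, the second factor above at \<open>q = 0\<close>.\<close>
definition clique_path_root :: "nat \<Rightarrow> real" where
  "clique_path_root n = 1 - (n + sqrt (5 * n\<^sup>2 - 4 * n)) / 2"

lemma bichromatic_root_clique_path_root:
  fixes n q :: nat
  assumes "n \<ge> 2"
  shows "bichromatic_root (complex_of_real (q + clique_path_root n))"
proof -
  define s where "s = sqrt (5 * real n ^ 2 - 4 * n)"
  have "real n \<ge> 1" using assms by simp
  then have "4 * real n \<le> 5 * real n ^ 2" by (simp add: power2_eq_square)
  then have s: "s\<^sup>2 = 5 * real n ^ 2 - 4 * n"
    unfolding s_def by simp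
  define r where "r = clique_path_root n"
  \<comment> \<open>With this form of \<open>s\<close>, the identity for the square of
    \<open>s\<close> is four times the quadratic equation for \<open>r\<close>.\<close>
  have r: "s = 2 - 2 * r - n"
    unfolding r_def clique_path_root_def s_def by (simp add: field_simps)
  have "n * (r - n) + (r - 1)\<^sup>2 = 0"
    using s unfolding r by (simp add: algebra_simps power2_eq_square)
  then have "complex_of_real (n * (r - n) + (r - 1)\<^sup>2) = 0" by simp
  then have "poly (chromatic_poly (clique_path_graph n q)) (complex_of_real (q + r)) = 0"
    using assms by (subst poly_chromatic_poly_clique_path_graph) (auto simp: algebra_simps)
  then show ?thesis
    unfolding bichromatic_root_def r_def
    using two_edge_coloured_clique_path_graph bichromatic_clique_path_graph[OF assms] by blast
qed

text \<open>The error is half of \<open>t - s\<close>. Rationalising turns this difference into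
  \<open>4 / 5 / (t + s)\<close>, and the denominator is at least \<open>n\<close>.\<close>

lemma clique_path_root_approx:
  assumes "n > 0"
  shows "\<bar>clique_path_root n - (1 + 1 / sqrt 5 - n * ((1 + sqrt 5) / 2))\<bar> \<le> 1 / n"
proof -
  define s where "s = sqrt (5 * real n ^ 2 - 4 * n)"
  \<comment> \<open>the linear function of \<open>n\<close> whose square differs from \<open>s\<^sup>2\<close> by a constant only\<close>
  define t where "t = sqrt 5 * n - 2 / sqrt 5"
  have n: "real n \<ge> 1" using assms by simp
  have t2: "t\<^sup>2 = 5 * real n ^ 2 - 4 * n + 4 / 5"
    unfolding t_def by (simp add: power2_diff power_mult_distrib power_divide)
  have t0: "t \<ge> n"
  proof -
    have "sqrt 5 \<ge> 2" by (simp add: real_le_rsqrt)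
    then have "2 * real n \<le> sqrt 5 * n" "2 / sqrt 5 \<le> 1" using n by auto
    then show ?thesis unfolding t_def using n by linarith
  qed
  have "4 * real n \<le> 5 * real n ^ 2" using n by (simp add: power2_eq_square)
  then have s: "s\<^sup>2 = 5 * real n ^ 2 - 4 * n" and s0: "s \<ge> 0"
    unfolding s_def by simp_all
  have prod: "(t - s) * (t + s) = 4 / 5"
    using t2 s by (simp add: algebra_simps power2_eq_square)
  have "t + s \<ge> n" using t0 s0 by simp
  then have pos: "t + s > 0" using n by linarith
  have "t - s = 4 / 5 / (t + s)" using prod pos by (simp add: field_simps)
  then have "t - s \<ge> 0" using pos by simp
  have "4 / 5 / (t + s) \<le> 1 / n" using \<open>t + s \<ge> n\<close> n by (intro frac_le) auto
  then have "t - s \<le> 1 / n" unfolding \<open>t - s = 4 / 5 / (t + s)\<close> .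
  moreover note \<open>t - s \<ge> 0\<close>
  moreover have "clique_path_root n - (1 + 1 / sqrt 5 - n * ((1 + sqrt 5) / 2)) = (t - s) / 2"
    unfolding clique_path_root_def t_def s_def by (simp add: field_simps)
  ultimately show ?thesis by simp
qed

section \<open>Irrationality and density\<close>

lemma sqrt_5_irrational: "sqrt 5 \<notin> \<rat>"
proof
  assume "sqrt 5 \<in> \<rat>"
  moreover have "algebraic_int (sqrt 5)" by (intro algebraic_int_sqrt) simp
  ultimately obtain m :: int where m: "sqrt 5 = of_int m"
    using rational_algebraic_int_is_int Ints_cases by blast
  have "2 < sqrt 5" "sqrt 5 < 3" by (simp_all add: real_less_rsqrt real_less_lsqrt)
  then have "2 < m" "m < 3" unfolding m by simp_all
  then show False by simp
qed

theorem theorem17: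
  "closure {x :: real. bichromatic_root (complex_of_real x)} = (UNIV :: real set)"
proof -
  define \<phi> :: real where "\<phi> = (1 + sqrt 5) / 2"
  have "\<phi> \<ge> 1" unfolding \<phi>_def by simp
  have "\<phi> \<notin> \<rat>"
  proof
    assume "\<phi> \<in> \<rat>"
    then have "2 * \<phi> - 1 \<in> \<rat>" by (intro Rats_diff Rats_mult) simp_all
    moreover have "2 * \<phi> - 1 = sqrt 5" by (simp add: \<phi>_def field_simps)
    ultimately show False using sqrt_5_irrational by simp
  qed
  then have irr: "real M * \<phi> \<notin> \<rat>" if "M > 0" for M
    using that Rats_divide[of "real M * \<phi>" "real M"] by auto
  have "\<exists>y. bichromatic_root (complex_of_real y) \<and> \<bar>y - x\<bar> < e" if "e > 0" for x e :: real
  proof -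
    \<comment> \<open>By the asymptotics, \<open>q + clique_path_root n\<close> is close to
      \<open>x\<close> once \<open>n * \<phi> - q\<close> is close to \<open>\<alpha>\<close> and
      \<open>n\<close> is large.\<close>
    define \<alpha> where "\<alpha> = 1 + 1 / sqrt 5 - x"
    \<comment> \<open>The three bounds serve in turn to make \<open>1 / n\<close> less than
      \<open>e / 2\<close>, to have \<open>n\<close> at least 2 for a bichromatic graph, and to keep
      \<open>h\<close> positive, since it becomes the number \<open>q\<close> of vertices.\<close>
    obtain M :: nat where M: "real M > max (2 / e) (max 2 (\<alpha> + e))"
      using reals_Archimedean2 by blast
    then have "M > 0" by auto
    \<comment> \<open>Kronecker's theorem is applied to \<open>M * \<phi>\<close> rather than
      \<open>\<phi>\<close>, as it gives no lower bound on \<open>k\<close> beyond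
      positivity.\<close>
    obtain k h :: int where k: "k > 0" and h: "\<bar>of_int k * (M * \<phi>) - of_int h - \<alpha>\<bar> < e / 2"
      using sequence_of_fractional_parts_is_dense[OF irr[OF \<open>M > 0\<close>] half_gt_zero[OF \<open>e > 0\<close>], of \<alpha>]
      by metis
    \<comment> \<open>a multiple of the large \<open>M\<close>, so that \<open>1 / n\<close> is small and the shift \<open>h\<close> is positive\<close>
    define n where "n = nat k * M"
    have "nat k \<ge> 1" using k by linarith
    then have "M \<le> n" unfolding n_def by simp
    have n: "of_int k * (M * \<phi>) = n * \<phi>" using k by (simp add: n_def)
    have "real M \<le> n * \<phi>"
      using mult_mono[of "real M" n 1 \<phi>] \<open>M \<le> n\<close> \<open>\<phi> \<ge> 1\<close> by simp
    then have "of_int h > (0 :: real)"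
      using h M \<open>e > 0\<close> unfolding n by linarith
    define q where "q = nat h"
    have q: "of_int h = real q" using \<open>of_int h > (0 :: real)\<close> by (simp add: q_def)
    have "2 / e < n" using M \<open>M \<le> n\<close> by linarith
    have "n \<ge> 2" using M \<open>M \<le> n\<close> by linarith
    then have "1 / n < e / 2"
      using \<open>2 / e < n\<close> \<open>e > 0\<close> by (simp add: pos_divide_less_eq mult.commute)
    have "\<bar>clique_path_root n - (1 + 1 / sqrt 5 - n * \<phi>)\<bar> \<le> 1 / n"
      unfolding \<phi>_def using \<open>n \<ge> 2\<close> by (intro clique_path_root_approx) simp
    \<comment> \<open>One half of \<open>e\<close> pays for the Kronecker approximation, the other
      for the asymptotics of the root.\<close>
    then have "\<bar>q + clique_path_root n - x\<bar> < e"
      using h \<open>1 / n < e / 2\<close> unfolding n q \<alpha>_def by linarith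
    then show ?thesis
      using bichromatic_root_clique_path_root[OF \<open>n \<ge> 2\<close>] by blast
  qed
  then show ?thesis
    by (auto simp: closure_approachable dist_real_def)
qed

end
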